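(* Let $\Delta=(V,\mathcal{A})$ be a finite digraph (multiple arcs and multiple loops allowed), let $\tau_1,\tau_2:\mathcal{A}\to\mathbb{C}$ be arbitrary maps, and let $t$ be an indeterminate. Define $\theta:\mathcal{A}\times\mathcal{A}\to\mathbb{C}$ by $$\theta(a,a')=\tau_1(a)\tau_2(a')\,\delta_{\mathfrak{h}(a)\,\mathfrak{t}(a')}-\epsilon(a,a'),$$ where $\epsilon(a,a')=1$ if $a'$ is an inverse of $a$ and $\epsilon(a,a')=0$ otherwise, and let $M_\theta=(\theta(a,a'))_{a,a'\in\mathcal{A}}$. Fix a total order $\le$ on $V$, let $\Phi_\Delta=\{(u,v)\in V\times V : u\le v,\ \mathcal{A}(u,v)\neq\emptyset\}$, and for $(u,v)\in\Phi_\Delta$ let $J(u,v)$, $K(u,v)$, $L(u,v)$, $f(u,v)$ be as in the context. Put $$A^\theta_\Delta=\sum_{(u,v)\in\Phi_\Delta}L(u,v)K(u,v),\qquad \underline{D}^\theta_\Delta=\sum_{(u,v)\in\Phi_\Delta}\frac{L(u,v)J(u,v)K(u,v)}{f(u,v)},$$ $$\underline{X}^\theta_\Delta=\sum_{(u,v)\in\Phi_\Delta,\ u\neq v}\frac{L(u,v)J(u,v)^2K(u,v)}{f(u,v)}$$ (all $|V|\times|V|$ matrices with entries rational functions of $t$). Then $$\det(I-tM_\theta)=\prod_{(u,v)\in\Phi_\Delta}f(u,v)\cdot\det\!\left(I-tA^\theta_\Delta+t^2\underline{D}^\theta_\Delta-t^3\underline{X}^\theta_\Delta\right).$$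
   Context: For an arc $a$, $\mathfrak{t}(a)$ and $\mathfrak{h}(a)$ denote its tail and head. For $u,v\in V$, $\mathcal{A}_{uv}=\{a\in\mathcal{A}:\mathfrak{t}(a)=u,\ \mathfrak{h}(a)=v\}$ and $\mathcal{A}(u,v)=\mathcal{A}_{uv}\cup\mathcal{A}_{vu}$. Inverse convention for digraphs: for $a\in\mathcal{A}_{uv}$, every arc in $\mathcal{A}_{vu}$ is an inverse of $a$ (in particular any two loops at the same vertex, including a loop and itself, are inverses of each other). $\delta_{xy}$ is the Kronecker delta. For $(u,v)\in\Phi_\Delta$: $J(u,v)$ is the square matrix indexed by $\mathcal{A}(u,v)$ whose $(a,a')$ entry is $1$ if $a'$ is an inverse of $a$ and $0$ otherwise; $K(u,v)$ is the $\mathcal{A}(u,v)\times V$ matrix with $(a,w)$ entry $\tau_1(a)\delta_{\mathfrak{h}(a)w}$; $L(u,v)$ is the $V\times\mathcal{A}(u,v)$ matrix with $(w,a')$ entry $\tau_2(a')\delta_{w\,\mathfrak{t}(a')}$; and $f(u,v)=1+|\mathcal{A}_{uu}|t$ if $u=v$, $f(u,v)=1-|\mathcal{A}_{uv}||\mathcal{A}_{vu}|t^2$ if $u\neq v$ (this equals $\det(I+tJ(u,v))$). *)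

theory Defs
  imports
    "Graph_Theory.Digraph"
    "Jordan_Normal_Form.Determinant"
    "HOL-Computational_Algebra.Polynomial_Factorial"
begin

text \<open>
  A matrix with rows indexed by a finite set \<open>R\<close> and columns indexed by a finite set \<open>C\<close> is a
  function \<open>'i \<Rightarrow> 'j \<Rightarrow> 'c\<close> of which only the values on \<open>R\<close> and \<open>C\<close> matter.
\<close>

definition kron :: "'i \<Rightarrow> 'i \<Rightarrow> 'c::zero_neq_one" where
  "kron x y = (if x = y then 1 else 0)"

definition mat_mul ::
  "'k set \<Rightarrow> ('i \<Rightarrow> 'k \<Rightarrow> 'c::semiring_0) \<Rightarrow> ('k \<Rightarrow> 'j \<Rightarrow> 'c) \<Rightarrow> 'i \<Rightarrow> 'j \<Rightarrow> 'c" where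
  "mat_mul S M N = (\<lambda>i j. \<Sum>k\<in>S. M i k * N k j)"

definition det_on :: "'i set \<Rightarrow> ('i \<Rightarrow> 'i \<Rightarrow> 'c::comm_ring_1) \<Rightarrow> 'c" where
  "det_on S M = (\<Sum>p | p permutes S. of_int (sign p) * (\<Prod>i\<in>S. M i (p i)))"

lemma det_on_eq_det:
  "det_on {0..<n} M = Determinant.det (mat n n (\<lambda>(i, j). M i j))"
  unfolding det_on_def Determinant.det_def
  by (auto intro!: sum.cong prod.cong simp: permutes_in_image)

type_synonym ratfun = "complex poly fract"

definition rf_const :: "complex \<Rightarrow> ratfun" where
  "rf_const c = to_fract [:c:]"

definition rf_t :: ratfun where
  "rf_t = to_fract [:0, 1:]"

definition arcs_from_to :: "('v, 'a) pre_digraph \<Rightarrow> 'v \<Rightarrow> 'v \<Rightarrow> 'a set" where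
  "arcs_from_to G u v = {a \<in> arcs G. tail G a = u \<and> head G a = v}"

definition arcs_between :: "('v, 'a) pre_digraph \<Rightarrow> 'v \<Rightarrow> 'v \<Rightarrow> 'a set" where
  "arcs_between G u v = arcs_from_to G u v \<union> arcs_from_to G v u"

definition is_inverse :: "('v, 'a) pre_digraph \<Rightarrow> 'a \<Rightarrow> 'a \<Rightarrow> bool" where
  "is_inverse G a a' \<longleftrightarrow> (\<exists>u v. a \<in> arcs_from_to G u v \<and> a' \<in> arcs_from_to G v u)"

definition Phi :: "('v, 'a) pre_digraph \<Rightarrow> 'v rel \<Rightarrow> ('v \<times> 'v) set" where
  "Phi G r = {(u, v) \<in> verts G \<times> verts G. (u, v) \<in> r \<and> arcs_between G u v \<noteq> {}}"

definition eps :: "('v, 'a) pre_digraph \<Rightarrow> 'a \<Rightarrow> 'a \<Rightarrow> complex" where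
  "eps G a a' = (if is_inverse G a a' then 1 else 0)"

definition theta ::
  "('v, 'a) pre_digraph \<Rightarrow> ('a \<Rightarrow> complex) \<Rightarrow> ('a \<Rightarrow> complex) \<Rightarrow> 'a \<Rightarrow> 'a \<Rightarrow> complex" where
  "theta G \<tau>1 \<tau>2 a a' = \<tau>1 a * \<tau>2 a' * kron (head G a) (tail G a') - eps G a a'"

text \<open>The next three matrices are extended by zero to arcs outside \<open>arcs_between G u v\<close>.\<close>

definition J_mat :: "('v, 'a) pre_digraph \<Rightarrow> 'v \<Rightarrow> 'v \<Rightarrow> 'a \<Rightarrow> 'a \<Rightarrow> complex" where
  "J_mat G u v a a' =
    (if a \<in> arcs_between G u v \<and> a' \<in> arcs_between G u v \<and> is_inverse G a a' then 1 else 0)"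

definition K_mat ::
  "('v, 'a) pre_digraph \<Rightarrow> ('a \<Rightarrow> complex) \<Rightarrow> 'v \<Rightarrow> 'v \<Rightarrow> 'a \<Rightarrow> 'v \<Rightarrow> complex" where
  "K_mat G \<tau>1 u v a w = (if a \<in> arcs_between G u v then \<tau>1 a * kron (head G a) w else 0)"

definition L_mat ::
  "('v, 'a) pre_digraph \<Rightarrow> ('a \<Rightarrow> complex) \<Rightarrow> 'v \<Rightarrow> 'v \<Rightarrow> 'v \<Rightarrow> 'a \<Rightarrow> complex" where
  "L_mat G \<tau>2 u v w a' = (if a' \<in> arcs_between G u v then \<tau>2 a' * kron w (tail G a') else 0)"

definition f_fac :: "('v, 'a) pre_digraph \<Rightarrow> 'v \<Rightarrow> 'v \<Rightarrow> ratfun" where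
  "f_fac G u v =
    (if u = v then 1 + of_nat (card (arcs_from_to G u u)) * rf_t
     else 1 - of_nat (card (arcs_from_to G u v)) * of_nat (card (arcs_from_to G v u)) * rf_t ^ 2)"

definition LK_mat ::
  "('v, 'a) pre_digraph \<Rightarrow> ('a \<Rightarrow> complex) \<Rightarrow> ('a \<Rightarrow> complex) \<Rightarrow> 'v \<Rightarrow> 'v \<Rightarrow> 'v \<Rightarrow> 'v \<Rightarrow> complex" where
  "LK_mat G \<tau>1 \<tau>2 u v =
    mat_mul (arcs_between G u v) (L_mat G \<tau>2 u v) (K_mat G \<tau>1 u v)"

definition LJK_mat ::
  "('v, 'a) pre_digraph \<Rightarrow> ('a \<Rightarrow> complex) \<Rightarrow> ('a \<Rightarrow> complex) \<Rightarrow> 'v \<Rightarrow> 'v \<Rightarrow> 'v \<Rightarrow> 'v \<Rightarrow> complex" where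
  "LJK_mat G \<tau>1 \<tau>2 u v =
    mat_mul (arcs_between G u v)
      (mat_mul (arcs_between G u v) (L_mat G \<tau>2 u v) (J_mat G u v))
      (K_mat G \<tau>1 u v)"

definition LJJK_mat ::
  "('v, 'a) pre_digraph \<Rightarrow> ('a \<Rightarrow> complex) \<Rightarrow> ('a \<Rightarrow> complex) \<Rightarrow> 'v \<Rightarrow> 'v \<Rightarrow> 'v \<Rightarrow> 'v \<Rightarrow> complex" where
  "LJJK_mat G \<tau>1 \<tau>2 u v =
    mat_mul (arcs_between G u v)
      (mat_mul (arcs_between G u v) (L_mat G \<tau>2 u v)
        (mat_mul (arcs_between G u v) (J_mat G u v) (J_mat G u v)))
      (K_mat G \<tau>1 u v)"

definition A_mat ::
  "('v, 'a) pre_digraph \<Rightarrow> 'v rel \<Rightarrow> ('a \<Rightarrow> complex) \<Rightarrow> ('a \<Rightarrow> complex) \<Rightarrow> 'v \<Rightarrow> 'v \<Rightarrow> ratfun" where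
  "A_mat G r \<tau>1 \<tau>2 w z = (\<Sum>(u, v)\<in>Phi G r. rf_const (LK_mat G \<tau>1 \<tau>2 u v w z))"

definition D_mat ::
  "('v, 'a) pre_digraph \<Rightarrow> 'v rel \<Rightarrow> ('a \<Rightarrow> complex) \<Rightarrow> ('a \<Rightarrow> complex) \<Rightarrow> 'v \<Rightarrow> 'v \<Rightarrow> ratfun" where
  "D_mat G r \<tau>1 \<tau>2 w z =
    (\<Sum>(u, v)\<in>Phi G r. rf_const (LJK_mat G \<tau>1 \<tau>2 u v w z) / f_fac G u v)"

definition X_mat ::
  "('v, 'a) pre_digraph \<Rightarrow> 'v rel \<Rightarrow> ('a \<Rightarrow> complex) \<Rightarrow> ('a \<Rightarrow> complex) \<Rightarrow> 'v \<Rightarrow> 'v \<Rightarrow> ratfun" where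
  "X_mat G r \<tau>1 \<tau>2 w z =
    (\<Sum>(u, v)\<in>{(u, v) \<in> Phi G r. u \<noteq> v}. rf_const (LJJK_mat G \<tau>1 \<tau>2 u v w z) / f_fac G u v)"

end

theory Submission
  imports Defs
begin

text \<open>
  Write \<open>I - t M\<close> as \<open>N - t K L\<close> with \<open>N = I + t \<epsilon>\<close>, where \<open>K\<close> and \<open>L\<close> factor the first term of
  \<open>\<theta>\<close> through the vertices. By the identity \<open>det (I - B C) = det (I - C B)\<close>, the determinant is
  \<open>det N\<close> times \<open>det (I - t L N\<inverse> K)\<close>, taken over the vertices. The matrix \<open>\<epsilon>\<close> is the sum of the mutually
  annihilating matrices \<open>J(u, v)\<close>, one for each element of \<open>\<Phi>\<close>. Hence \<open>det N\<close> is the product of the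
  \<open>det (I + t J(u, v))\<close>, and \<open>N\<inverse>\<close> is obtained blockwise from \<open>J\<^sup>2 = n\<^bsub>uu\<^esub> J\<close> for \<open>u = v\<close> and
  \<open>J\<^sup>3 = n\<^bsub>uv\<^esub> n\<^bsub>vu\<^esub> J\<close> for \<open>u \<noteq> v\<close>, with
  \<open>n\<^bsub>uv\<^esub>\<close> the number of arcs from \<open>u\<close> to \<open>v\<close>.
\<close>

subsection \<open>Determinants over finite index sets\<close>

lemma det_on_cong:
  assumes "\<And>i j. i \<in> S \<Longrightarrow> j \<in> S \<Longrightarrow> M i j = N i j"
  shows "det_on S M = det_on S N"
  unfolding det_on_def
  by (intro sum.cong refl arg_cong2[where f = "(*)"] prod.cong assms)
     (auto simp: permutes_in_image)

text \<open>Conjugation along \<open>h\<close> is a bijection between the permutations of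
  \<open>S\<close> and those of \<open>T\<close> and preserves signs, so the two Leibniz sums agree
  term by term. With an enumeration as \<open>h\<close>, results about \<open>mat\<close> carry over
  to \<open>det_on\<close>.\<close>

lemma det_on_reindex:
  fixes M :: "'j \<Rightarrow> 'j \<Rightarrow> 'c::comm_ring_1"
  assumes h: "bij_betw h S T" and fin: "finite S"
  shows "det_on T M = det_on S (\<lambda>i j. M (h i) (h j))"
proof -
  have inj: "inj_on h S" and img: "h ` S = T"
    using h by (auto simp: bij_betw_def)
  have bij: "bij_betw (map_permutation S h) {p. p permutes S} {p. p permutes T}"
    using bij_betw_permutations[OF h]
    by (simp add: map_permutation_def[abs_def] restrict_id_def[abs_def] img o_def)
  have "det_on T M = (\<Sum>p | p permutes S. of_int (sign (map_permutation S h p)) *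
      (\<Prod>i\<in>T. M i (map_permutation S h p i)))"
    unfolding det_on_def by (rule sum.reindex_bij_betw[OF bij, symmetric])
  also have "\<dots> = (\<Sum>p | p permutes S. of_int (sign p) * (\<Prod>i\<in>S. M (h i) (h (p i))))"
  proof (intro sum.cong refl, clarify)
    fix p assume p: "p permutes S"
    have "(\<Prod>i\<in>T. M i (map_permutation S h p i)) =
        (\<Prod>i\<in>S. M (h i) (map_permutation S h p (h i)))"
      by (rule prod.reindex_bij_betw[OF h, symmetric])
    also have "\<dots> = (\<Prod>i\<in>S. M (h i) (h (p i)))"
      by (intro prod.cong refl) (simp add: map_permutation_def restrict_id_def inj)
    finally show "of_int (sign (map_permutation S h p)) * (\<Prod>i\<in>T. M i (map_permutation S h p i)) =
        of_int (sign p) * (\<Prod>i\<in>S. M (h i) (h (p i)))"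
      by (simp add: sign_map_permutation[OF inj p fin])
  qed
  finally show ?thesis unfolding det_on_def .
qed

lemma det_on_eq_det_enum:
  assumes "bij_betw h {0..<n} S"
  shows "det_on S M = Determinant.det (mat n n (\<lambda>(i, j). M (h i) (h j)))"
  by (simp add: det_on_reindex[OF assms] det_on_eq_det)

lemma mat_mul_enum:
  assumes "bij_betw h {0..<n} S"
  shows "mat_mul S M N i j = (\<Sum>k = 0..<n. M i (h k) * N (h k) j)"
  unfolding mat_mul_def by (rule sum.reindex_bij_betw[OF assms, symmetric])

lemma det_on_mat_mul:
  fixes M N :: "'i \<Rightarrow> 'i \<Rightarrow> 'c::comm_ring_1"
  assumes "finite S"
  shows "det_on S (mat_mul S M N) = det_on S M * det_on S N"
proof -
  define n where "n = card S"
  obtain h where h: "bij_betw h {0..<n} S"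
    using ex_bij_betw_nat_finite[OF assms] unfolding n_def by blast
  have "mat n n (\<lambda>(i, j). mat_mul S M N (h i) (h j)) =
      mat n n (\<lambda>(i, j). M (h i) (h j)) * mat n n (\<lambda>(i, j). N (h i) (h j))"
    by (rule eq_matI) (auto simp: mat_mul_enum[OF h] scalar_prod_def)
  then show ?thesis
    by (simp add: det_on_eq_det_enum[OF h] det_mult[where n = n])
qed

lemma det_on_kron [simp]:
  assumes "finite S"
  shows "det_on S kron = (1 :: 'c::comm_ring_1)"
proof -
  obtain h where h: "bij_betw h {0..<card S} S"
    using ex_bij_betw_nat_finite[OF assms] by blast
  then have "mat (card S) (card S) (\<lambda>(i, j). kron (h i) (h j)) = (1\<^sub>m (card S) :: 'c mat)"
    by (intro eq_matI) (auto simp: kron_def bij_betw_def inj_on_def)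
  then show ?thesis by (simp add: det_on_eq_det_enum[OF h])
qed

text \<open>\<open>?Q\<close> is unit lower triangular and clears the lower left block of
  \<open>?P\<close> from either side. Both products are block upper triangular, with the nontrivial
  diagonal block I - B C in one case and I - C B in the other, and their determinants agree because
  scalars commute.\<close>

lemma det_one_minus_mult_commute:
  fixes B C :: "'c::idom mat"
  assumes B: "B \<in> carrier_mat n m" and C: "C \<in> carrier_mat m n"
  shows "Determinant.det (1\<^sub>m n - B * C) = Determinant.det (1\<^sub>m m - C * B)"
proof -
  let ?P = "four_block_mat (1\<^sub>m n) B C (1\<^sub>m m)"
  let ?Q = "four_block_mat (1\<^sub>m n) (0\<^sub>m n m) (- C) (1\<^sub>m m)"
  have P: "?P \<in> carrier_mat (n + m) (n + m)" and Q: "?Q \<in> carrier_mat (n + m) (n + m)"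
    by auto
  have "?P * ?Q = four_block_mat (1\<^sub>m n - B * C) B (0\<^sub>m m n) (1\<^sub>m m)"
    using B C by (subst mult_four_block_mat[of _ n n _ m _ m _ _ n _ m])
      (auto intro!: cong_four_block_mat simp: minus_add_uminus_mat[of _ n n])
  then have PQ: "Determinant.det (?P * ?Q) = Determinant.det (1\<^sub>m n - B * C)"
    using B C det_four_block_mat_lower_left_zero[of "1\<^sub>m n - B * C" n B m "0\<^sub>m m n" "1\<^sub>m m"]
    by (simp add: minus_carrier_mat mult_carrier_mat[OF B C])
  have "?Q * ?P = four_block_mat (1\<^sub>m n) B (0\<^sub>m m n) (1\<^sub>m m - C * B)"
    using B C by (subst mult_four_block_mat[of _ n n _ m _ m _ _ n _ m])
      (auto intro!: cong_four_block_mat eq_matI)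
  then have "Determinant.det (?Q * ?P) = Determinant.det (1\<^sub>m m - C * B)"
    using B C det_four_block_mat_lower_left_zero[of "1\<^sub>m n" n B m "0\<^sub>m m n" "1\<^sub>m m - C * B"]
    by (simp add: minus_carrier_mat mult_carrier_mat[OF C B])
  with PQ show ?thesis by (simp add: det_mult[OF P Q] det_mult[OF Q P] mult.commute)
qed

lemma det_on_kron_minus_mat_mul_commute:
  fixes B :: "'i \<Rightarrow> 'j \<Rightarrow> 'c::idom"
  assumes "finite S" "finite T"
  shows "det_on S (\<lambda>i j. kron i j - mat_mul T B C i j) =
    det_on T (\<lambda>i j. kron i j - mat_mul S C B i j)"
proof -
  define n m where "n = card S" and "m = card T"
  obtain h where h: "bij_betw h {0..<n} S"
    using ex_bij_betw_nat_finite[OF assms(1)] unfolding n_def by blast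
  obtain g where g: "bij_betw g {0..<m} T"
    using ex_bij_betw_nat_finite[OF assms(2)] unfolding m_def by blast
  let ?B = "mat n m (\<lambda>(i, j). B (h i) (g j))" and ?C = "mat m n (\<lambda>(i, j). C (g i) (h j))"
  have "mat n n (\<lambda>(i, j). kron (h i) (h j) - mat_mul T B C (h i) (h j)) = 1\<^sub>m n - ?B * ?C"
    using h by (intro eq_matI)
      (auto simp: mat_mul_enum[OF g] scalar_prod_def kron_def bij_betw_def inj_on_def)
  moreover have
    "mat m m (\<lambda>(i, j). kron (g i) (g j) - mat_mul S C B (g i) (g j)) = 1\<^sub>m m - ?C * ?B"
    using g by (intro eq_matI)
      (auto simp: mat_mul_enum[OF h] scalar_prod_def kron_def bij_betw_def inj_on_def)
  ultimately show ?thesis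
    using det_one_minus_mult_commute[of ?B n m ?C]
    by (simp add: det_on_eq_det_enum[OF h] det_on_eq_det_enum[OF g])
qed

lemma sum_kron_mult:
  fixes X :: "'i \<Rightarrow> 'c::comm_ring_1"
  assumes "finite S" "i \<in> S"
  shows "(\<Sum>k\<in>S. kron i k * X k) = X i"
proof -
  have "(\<Sum>k\<in>S. kron i k * X k) = (\<Sum>k\<in>S. if i = k then X k else 0)"
    by (intro sum.cong) (auto simp: kron_def)
  then show ?thesis using assms by simp
qed

lemma sum_mult_kron:
  fixes X :: "'i \<Rightarrow> 'c::comm_ring_1"
  assumes "finite S" "j \<in> S"
  shows "(\<Sum>k\<in>S. X k * kron k j) = X j"
proof -
  have "(\<Sum>k\<in>S. X k * kron k j) = (\<Sum>k\<in>S. if k = j then X k else 0)"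
    by (intro sum.cong) (auto simp: kron_def)
  then show ?thesis using assms by simp
qed

lemma mat_mul_assoc:
  fixes M :: "'i \<Rightarrow> 'k \<Rightarrow> 'c::semiring_0"
  shows "mat_mul T (mat_mul S M N) P = mat_mul S M (mat_mul T N P)"
  unfolding mat_mul_def sum_distrib_left sum_distrib_right
  by (subst sum.swap) (simp add: mult.assoc)

text \<open>Since N N' = I on \<open>S\<close>, one has N - K L = N (I - (N' K) L). Multiplicativity
  splits off det N, and exchanging the factors N' K and L moves the other determinant from
  \<open>S\<close> to \<open>T\<close>.\<close>

lemma det_on_minus_mat_mul:
  fixes N :: "'i \<Rightarrow> 'i \<Rightarrow> 'c::idom"
  assumes S: "finite S" and T: "finite T"
    and inv: "\<And>i j. i \<in> S \<Longrightarrow> j \<in> S \<Longrightarrow> mat_mul S N N' i j = kron i j"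
  shows "det_on S (\<lambda>i j. N i j - mat_mul T K L i j) =
    det_on S N * det_on T (\<lambda>i j. kron i j - mat_mul S L (mat_mul S N' K) i j)"
proof -
  have "N i j - mat_mul T K L i j =
      mat_mul S N (\<lambda>i j. kron i j - mat_mul T (mat_mul S N' K) L i j) i j"
    if ij: "i \<in> S" "j \<in> S" for i j
  proof -
    have "mat_mul S N (mat_mul T (mat_mul S N' K) L) i j =
        mat_mul S (mat_mul S N N') (mat_mul T K L) i j"
      by (simp add: mat_mul_assoc)
    also have "\<dots> = (\<Sum>k\<in>S. kron i k * mat_mul T K L k j)"
      unfolding mat_mul_def[of S "mat_mul S N N'"] using ij by (intro sum.cong) (auto simp: inv)
    also have "\<dots> = mat_mul T K L i j"
      using ij S by (simp add: sum_kron_mult)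
    finally have *: "mat_mul S N (mat_mul T (mat_mul S N' K) L) i j = mat_mul T K L i j" .
    have "(\<Sum>k\<in>S. N i k * kron k j) = N i j"
      using ij S by (simp add: sum_mult_kron)
    with * show ?thesis
      by (simp add: mat_mul_def[of S N] right_diff_distrib sum_subtractf)
  qed
  then have "det_on S (\<lambda>i j. N i j - mat_mul T K L i j) =
      det_on S (mat_mul S N (\<lambda>i j. kron i j - mat_mul T (mat_mul S N' K) L i j))"
    by (intro det_on_cong)
  also have "\<dots> = det_on S N * det_on S (\<lambda>i j. kron i j - mat_mul T (mat_mul S N' K) L i j)"
    by (rule det_on_mat_mul[OF S])
  finally show ?thesis
    by (simp add: det_on_kron_minus_mat_mul_commute[OF S T])
qed

text \<open>All cross terms vanish in the product of the matrices I + E k, so this product is I plus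
  the sum of the E k. The induction splits off one factor at a time.\<close>

lemma det_on_kron_plus_sum_orthogonal:
  fixes E :: "'k \<Rightarrow> 'i \<Rightarrow> 'i \<Rightarrow> 'c::comm_ring_1"
  assumes I: "finite I" and S: "finite S"
    and orth: "\<And>k l i j. k \<in> I \<Longrightarrow> l \<in> I \<Longrightarrow> k \<noteq> l \<Longrightarrow> mat_mul S (E k) (E l) i j = 0"
  shows "det_on S (\<lambda>i j. kron i j + (\<Sum>k\<in>I. E k i j)) =
    (\<Prod>k\<in>I. det_on S (\<lambda>i j. kron i j + E k i j))"
  using I orth
proof (induction I rule: finite_induct)
  case empty
  show ?case using S by simp
next
  case (insert x F)
  have "kron i j + (\<Sum>k\<in>insert x F. E k i j) =
      mat_mul S (\<lambda>i j. kron i j + E x i j) (\<lambda>i j. kron i j + (\<Sum>k\<in>F. E k i j)) i j"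
    if ij: "i \<in> S" "j \<in> S" for i j
  proof -
    have "(\<Sum>l\<in>S. E x i l * (\<Sum>k\<in>F. E k l j)) = (\<Sum>k\<in>F. mat_mul S (E x) (E k) i j)"
      unfolding mat_mul_def sum_distrib_left by (rule sum.swap)
    also have "\<dots> = 0" using insert.prems insert.hyps by (intro sum.neutral) auto
    finally have "(\<Sum>l\<in>S. E x i l * (\<Sum>k\<in>F. E k l j)) = 0" .
    then show ?thesis
      using ij S insert.hyps
      by (simp add: sum_kron_mult sum_mult_kron mat_mul_def distrib_left distrib_right sum.distrib add_ac)
  qed
  then have "det_on S (\<lambda>i j. kron i j + (\<Sum>k\<in>insert x F. E k i j)) =
      det_on S (mat_mul S (\<lambda>i j. kron i j + E x i j) (\<lambda>i j. kron i j + (\<Sum>k\<in>F. E k i j)))"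
    by (intro det_on_cong)
  also have "\<dots> = det_on S (\<lambda>i j. kron i j + E x i j) *
      (\<Prod>k\<in>F. det_on S (\<lambda>i j. kron i j + E k i j))"
    by (simp add: det_on_mat_mul[OF S] insert.IH insert.prems)
  finally show ?case using insert.hyps by simp
qed

text \<open>The assumption \<open>inv\<close> expresses (I + E k)(I + F k) = I. By
  \<open>orth\<close> only the products E k F k survive in the expansion, so the blockwise inverses
  assemble to a right inverse of the whole sum.\<close>

lemma mat_mul_kron_plus_sum_orthogonal:
  fixes E F :: "'k \<Rightarrow> 'i \<Rightarrow> 'i \<Rightarrow> 'c::comm_ring_1"
  assumes I: "finite I" and S: "finite S"
    and orth: "\<And>k l i j. k \<in> I \<Longrightarrow> l \<in> I \<Longrightarrow> k \<noteq> l \<Longrightarrow> mat_mul S (E k) (F l) i j = 0"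
    and inv: "\<And>k i j. k \<in> I \<Longrightarrow> F k i j + E k i j + mat_mul S (E k) (F k) i j = 0"
    and ij: "i \<in> S" "j \<in> S"
  shows "mat_mul S (\<lambda>i j. kron i j + (\<Sum>k\<in>I. E k i j)) (\<lambda>i j. kron i j + (\<Sum>k\<in>I. F k i j)) i j =
    kron i j"
proof -
  have "(\<Sum>s\<in>S. (\<Sum>k\<in>I. E k i s) * (\<Sum>l\<in>I. F l s j)) =
      (\<Sum>s\<in>S. \<Sum>k\<in>I. \<Sum>l\<in>I. E k i s * F l s j)"
    by (simp add: sum_product)
  also have "\<dots> = (\<Sum>k\<in>I. \<Sum>l\<in>I. mat_mul S (E k) (F l) i j)"
    unfolding mat_mul_def by (subst sum.swap, rule sum.cong[OF refl], rule sum.swap)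
  also have "\<dots> = (\<Sum>k\<in>I. \<Sum>l\<in>I. if k = l then mat_mul S (E k) (F k) i j else 0)"
    by (intro sum.cong refl) (auto simp: orth)
  also have "\<dots> = (\<Sum>k\<in>I. mat_mul S (E k) (F k) i j)"
    using I by simp
  finally have "(\<Sum>s\<in>S. (\<Sum>k\<in>I. E k i s) * (\<Sum>l\<in>I. F l s j)) =
      (\<Sum>k\<in>I. mat_mul S (E k) (F k) i j)" .
  moreover have "(\<Sum>k\<in>I. F k i j) + (\<Sum>k\<in>I. E k i j) + (\<Sum>k\<in>I. mat_mul S (E k) (F k) i j) = 0"
    by (simp add: inv flip: sum.distrib)
  ultimately show ?thesis
    using ij S
    by (simp add: mat_mul_def[of S "\<lambda>i j. kron i j + _ i j"] distrib_left distrib_right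
        sum.distrib sum_kron_mult sum_mult_kron add_ac)
qed

lemma det_on_singleton: "det_on {u} M = M u u"
  by (simp add: det_on_def)

lemma det_on_pair:
  assumes "u \<noteq> v"
  shows "det_on {u, v} M = M u u * M v v - M u v * M v u"
proof -
  have "{p. p permutes {u, v}} = {id, Transposition.transpose u v}"
    by (auto simp: permutes_doubleton_iff)
  moreover have "id \<noteq> Transposition.transpose u v"
    using assms by (metis id_apply transpose_apply_first)
  ultimately show ?thesis
    using assms by (simp add: det_on_def sign_swap_id)
qed

subsection \<open>The blocks of the inversion matrix\<close>

lemma rf_const_simps [simp]:
  "rf_const 0 = 0" "rf_const 1 = 1"
  "rf_const (x + y) = rf_const x + rf_const y"
  "rf_const (x - y) = rf_const x - rf_const y"
  "rf_const (x * y) = rf_const x * rf_const y"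
  by (simp_all add: rf_const_def flip: to_fract_add to_fract_diff to_fract_mult one_pCons)

lemma rf_const_sum [simp]: "rf_const (sum g S) = (\<Sum>x\<in>S. rf_const (g x))"
  by (induction S rule: infinite_finite_induct) auto

lemma rf_const_of_nat [simp]: "rf_const (of_nat n) = of_nat n"
  by (induction n) auto

lemma rf_const_kron [simp]: "rf_const (kron x y) = kron x y"
  by (simp add: kron_def)

text \<open>In both cases f is the image of a polynomial in t with constant coefficient 1. This
  justifies clearing the denominators below.\<close>

lemma f_fac_nonzero: "f_fac G u v \<noteq> 0"
proof -
  have of_nat: "of_nat n = to_fract [:of_nat n :: complex:]" for n
    using rf_const_of_nat[of n] by (simp add: rf_const_def)
  have "1 + of_nat n * rf_t = to_fract [:1, of_nat n:]" for n
  proof -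
    have "[:1, of_nat n:] = 1 + [:of_nat n:] * [:0, 1 :: complex:]"
      by (simp add: one_pCons)
    then show ?thesis by (simp only: to_fract_add to_fract_mult to_fract_1 of_nat rf_t_def)
  qed
  moreover have "1 - of_nat n * of_nat m * rf_t ^ 2 =
      to_fract [:1, 0, - (of_nat n * of_nat m):]" for n m
  proof -
    have "[:1, 0, - (of_nat n * of_nat m):] =
        1 - [:of_nat n:] * [:of_nat m:] * ([:0, 1:] * [:0, 1 :: complex:])"
      by (simp add: one_pCons)
    then show ?thesis
      by (simp only: to_fract_diff to_fract_mult to_fract_1 of_nat rf_t_def power2_eq_square)
  qed
  ultimately show ?thesis by (simp add: f_fac_def)
qed

lemma arcs_between_iff:
  "a \<in> arcs_between G u v \<longleftrightarrow>
    a \<in> arcs G \<and> (tail G a = u \<and> head G a = v \<or> tail G a = v \<and> head G a = u)"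
  by (auto simp: arcs_between_def arcs_from_to_def)

lemma arcs_between_subset: "arcs_between G u v \<subseteq> arcs G"
  by (auto simp: arcs_between_iff)

lemma arcs_betweenE:
  assumes "a \<in> arcs_between G u v"
  obtains "a \<in> arcs G" "tail G a = u" "head G a = v"
  | "a \<in> arcs G" "tail G a = v" "head G a = u"
  using assms by (auto simp: arcs_between_iff)

lemma arcs_between_Int_arcs_from_to:
  assumes "a \<in> arcs_between G u v"
  shows "arcs_between G u v \<inter> arcs_from_to G (head G a) (tail G a) =
    arcs_from_to G (head G a) (tail G a)"
  using assms by (auto simp: arcs_between_def arcs_from_to_def)

lemma is_inverse_iff:
  "is_inverse G a b \<longleftrightarrow> a \<in> arcs G \<and> b \<in> arcs G \<and> tail G a = head G b \<and> head G a = tail G b"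
  by (auto simp: is_inverse_def arcs_from_to_def)

text \<open>Inside one block each arc joins u and v in some direction, so a single matching pair of
  endpoints forces the other pair to match.\<close>

lemma J_mat_eq:
  "J_mat G u v a b =
    (if a \<in> arcs_between G u v \<and> b \<in> arcs_between G u v \<and> tail G a = head G b then 1 else 0)"
  by (auto simp: J_mat_def is_inverse_iff arcs_between_iff)

definition JJ_mat :: "('v, 'a) pre_digraph \<Rightarrow> 'v \<Rightarrow> 'v \<Rightarrow> 'a \<Rightarrow> 'a \<Rightarrow> complex" where
  "JJ_mat G u v = mat_mul (arcs_between G u v) (J_mat G u v) (J_mat G u v)"

text \<open>The matrix \<open>(I + t J(u, v))\<inverse> - I\<close>.\<close>

definition block_inv :: "('v, 'a) pre_digraph \<Rightarrow> 'v \<Rightarrow> 'v \<Rightarrow> 'a \<Rightarrow> 'a \<Rightarrow> ratfun" where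
  "block_inv G u v a b =
    (if u = v then 0 else rf_t ^ 2 * rf_const (JJ_mat G u v a b) / f_fac G u v)
      - rf_t * rf_const (J_mat G u v a b) / f_fac G u v"

lemma JJ_mat_outside:
  assumes "\<not> (a \<in> arcs_between G u v \<and> b \<in> arcs_between G u v)"
  shows "JJ_mat G u v a b = 0"
  using assms by (auto simp: JJ_mat_def mat_mul_def J_mat_def)

lemma block_inv_outside:
  assumes "\<not> (a \<in> arcs_between G u v \<and> b \<in> arcs_between G u v)"
  shows "block_inv G u v a b = 0"
  using assms by (auto simp: block_inv_def JJ_mat_outside J_mat_def)

context fin_digraph
begin

lemma finite_arcs_between [simp]: "finite (arcs_between G u v)"
  by (rule finite_subset[OF _ finite_arcs]) (auto simp: arcs_between_iff)

text \<open>Any two loops at u are mutually inverse, so J(u, u) is the all-ones matrix on the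
  block.\<close>

lemma JJ_mat_loop: "JJ_mat G u u a b = of_nat (card (arcs_from_to G u u)) * J_mat G u u a b"
proof -
  have "arcs_between G u u = arcs_from_to G u u"
    by (auto simp: arcs_between_def)
  moreover have "J_mat G u u a k * J_mat G u u k b = J_mat G u u a b"
    if "k \<in> arcs_between G u u" for k
  proof -
    have J: "J_mat G u u x y =
        (if x \<in> arcs_between G u u \<and> y \<in> arcs_between G u u then 1 else 0)" for x y
      by (simp add: J_mat_def is_inverse_iff arcs_between_iff)
    show ?thesis using that by (simp add: J)
  qed
  ultimately show ?thesis
    by (simp add: JJ_mat_def mat_mul_def)
qed

text \<open>A walk from a to b through an intermediate arc k reverses direction twice: b is parallel
  to a, and k ranges over all arcs opposite to a.\<close>

lemma JJ_mat_nonloop: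
  assumes "u \<noteq> v"
  shows "JJ_mat G u v a b =
    (if a \<in> arcs_between G u v \<and> b \<in> arcs_between G u v \<and> tail G a = tail G b
     then of_nat (card (arcs_from_to G (head G a) (tail G a))) else 0)"
proof -
  have "JJ_mat G u v a b = (\<Sum>k\<in>arcs_between G u v.
      if a \<in> arcs_between G u v \<and> b \<in> arcs_between G u v \<and> tail G a = tail G b \<and>
        k \<in> arcs_from_to G (head G a) (tail G a) then 1 else 0)"
    unfolding JJ_mat_def mat_mul_def
  proof (rule sum.cong[OF refl])
    fix k assume k: "k \<in> arcs_between G u v"
    show "J_mat G u v a k * J_mat G u v k b =
      (if a \<in> arcs_between G u v \<and> b \<in> arcs_between G u v \<and> tail G a = tail G b \<and>
        k \<in> arcs_from_to G (head G a) (tail G a) then 1 else 0)"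
    \<comment> \<open>Within the block, the claim is checked for each choice of directions of a, b
      and k; u and v being distinct decides every endpoint comparison.\<close>
    proof (cases "a \<in> arcs_between G u v \<and> b \<in> arcs_between G u v")
      case True
      then show ?thesis
        using k assms unfolding J_mat_eq by (elim conjE arcs_betweenE) (simp_all add: arcs_between_iff arcs_from_to_def)
    qed (auto simp: J_mat_eq)
  qed
  also have "\<dots> = (if a \<in> arcs_between G u v \<and> b \<in> arcs_between G u v \<and> tail G a = tail G b
     then of_nat (card (arcs_between G u v \<inter> arcs_from_to G (head G a) (tail G a))) else 0)"
    by (auto simp: sum.If_cases Int_def)
  also have "\<dots> = (if a \<in> arcs_between G u v \<and> b \<in> arcs_between G u v \<and> tail G a = tail G b
     then of_nat (card (arcs_from_to G (head G a) (tail G a))) else 0)"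
    using arcs_between_Int_arcs_from_to[of a G u v] by (intro if_cong refl) (elim conjE, simp only:)
  finally show ?thesis .
qed

text \<open>The first factor J lets k range over the arcs opposite to a, and each such k contributes
  the number of arcs parallel to a. The product of these two counts does not depend on the direction
  of a.\<close>

lemma J_mat_cube:
  assumes "u \<noteq> v"
  shows "mat_mul (arcs_between G u v) (J_mat G u v) (JJ_mat G u v) a b =
    of_nat (card (arcs_from_to G u v)) * of_nat (card (arcs_from_to G v u)) * J_mat G u v a b"
proof -
  let ?A = "arcs_between G u v"
  have "mat_mul ?A (J_mat G u v) (JJ_mat G u v) a b =
    (\<Sum>k\<in>?A. if a \<in> ?A \<and> b \<in> ?A \<and> tail G a = head G b \<and>
        k \<in> arcs_from_to G (head G a) (tail G a)
      then of_nat (card (arcs_from_to G (tail G a) (head G a))) else 0)"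
    unfolding mat_mul_def
  proof (rule sum.cong[OF refl])
    fix k assume k: "k \<in> ?A"
    show "J_mat G u v a k * JJ_mat G u v k b =
      (if a \<in> ?A \<and> b \<in> ?A \<and> tail G a = head G b \<and> k \<in> arcs_from_to G (head G a) (tail G a)
       then of_nat (card (arcs_from_to G (tail G a) (head G a))) else 0)"
    proof (cases "a \<in> ?A \<and> b \<in> ?A")
      case True
      then show ?thesis
        using k assms unfolding J_mat_eq JJ_mat_nonloop[OF assms]
        by (elim conjE arcs_betweenE) (simp_all add: arcs_between_iff arcs_from_to_def)
    qed (auto simp: J_mat_eq JJ_mat_nonloop[OF assms])
  qed
  also have "\<dots> = (if a \<in> ?A \<and> b \<in> ?A \<and> tail G a = head G b
     then of_nat (card (?A \<inter> arcs_from_to G (head G a) (tail G a))) *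
       of_nat (card (arcs_from_to G (tail G a) (head G a))) else 0)"
    by (auto simp: sum.If_cases Int_def)
  also have "\<dots> = (if a \<in> ?A \<and> b \<in> ?A \<and> tail G a = head G b
     then of_nat (card (arcs_from_to G u v)) * of_nat (card (arcs_from_to G v u)) else 0)"
  proof (intro if_cong refl)
    assume "a \<in> ?A \<and> b \<in> ?A \<and> tail G a = head G b"
    then have a: "a \<in> ?A" by simp
    then show "of_nat (card (?A \<inter> arcs_from_to G (head G a) (tail G a))) *
        of_nat (card (arcs_from_to G (tail G a) (head G a))) =
      (of_nat (card (arcs_from_to G u v)) * of_nat (card (arcs_from_to G v u)) :: complex)"
      unfolding arcs_between_Int_arcs_from_to[OF a] by (elim arcs_betweenE) simp_all
  qed
  finally show ?thesis by (simp add: J_mat_eq)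
qed

text \<open>This is (I + t J)(I + F) = I with F = \<open>block_inv\<close>, expanded and without the
  identity. Reducing J^2 for loops, or J^3 otherwise, to a multiple of J leaves a multiple of t J
  that vanishes by the choice of f.\<close>

lemma block_inv_eq:
  "block_inv G u v a b + rf_t * rf_const (J_mat G u v a b)
    + mat_mul (arcs G) (\<lambda>a b. rf_t * rf_const (J_mat G u v a b)) (block_inv G u v) a b = 0"
proof -
  let ?A = "arcs_between G u v" and ?f = "f_fac G u v"
  have "mat_mul (arcs G) (\<lambda>a b. rf_t * rf_const (J_mat G u v a b)) (block_inv G u v) a b =
      (\<Sum>k\<in>?A. rf_t * rf_const (J_mat G u v a k) * block_inv G u v k b)"
    unfolding mat_mul_def
    by (rule sum.mono_neutral_right) (auto simp: J_mat_def arcs_between_iff)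
  also have "\<dots> =
    (if u = v then 0
     else rf_t ^ 3 * rf_const (mat_mul ?A (J_mat G u v) (JJ_mat G u v) a b) / ?f)
      - rf_t ^ 2 * rf_const (JJ_mat G u v a b) / ?f"
    by (simp add: block_inv_def mat_mul_def[of _ "J_mat G u v"] right_diff_distrib sum_subtractf
        sum_distrib_left sum_divide_distrib JJ_mat_def[of G u v] power2_eq_square power3_eq_cube mult_ac)
  finally have *: "mat_mul (arcs G) (\<lambda>a b. rf_t * rf_const (J_mat G u v a b)) (block_inv G u v) a b =
    (if u = v then 0
     else rf_t ^ 3 * rf_const (mat_mul ?A (J_mat G u v) (JJ_mat G u v) a b) / ?f)
      - rf_t ^ 2 * rf_const (JJ_mat G u v a b) / ?f" .
  have f: "?f \<noteq> 0" by (rule f_fac_nonzero)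
  let ?j = "rf_const (J_mat G u v a b)"
  show ?thesis
  proof (cases "u = v")
    case True
    let ?n = "of_nat (card (arcs_from_to G u u)) :: ratfun"
    have fe: "?f = 1 + ?n * rf_t"
      using True by (simp add: f_fac_def)
    have "block_inv G u v a b + rf_t * ?j
        + mat_mul (arcs G) (\<lambda>a b. rf_t * rf_const (J_mat G u v a b)) (block_inv G u v) a b =
      (rf_t * ?j * ?f - rf_t * ?j - rf_t ^ 2 * (?n * ?j)) / ?f"
      unfolding * using True f
      by (simp add: block_inv_def JJ_mat_loop diff_divide_distrib)
    \<comment> \<open>The numerator is t J (f - 1 - n t).\<close>
    also have "rf_t * ?j * ?f - rf_t * ?j - rf_t ^ 2 * (?n * ?j) = 0"
      unfolding fe by (simp add: algebra_simps power2_eq_square)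
    finally show ?thesis by simp
  next
    case False
    let ?m = "of_nat (card (arcs_from_to G u v)) * of_nat (card (arcs_from_to G v u)) :: ratfun"
    have fe: "?f = 1 - ?m * rf_t ^ 2"
      using False by (simp add: f_fac_def)
    \<comment> \<open>The two J^2 terms cancel, leaving the numerator t J (f - 1 + m t^2), where m
      is the product of the two arc counts.\<close>
    have "block_inv G u v a b + rf_t * ?j
        + mat_mul (arcs G) (\<lambda>a b. rf_t * rf_const (J_mat G u v a b)) (block_inv G u v) a b =
      (rf_t * ?j * ?f - rf_t * ?j + rf_t ^ 3 * (?m * ?j)) / ?f"
      unfolding * using False f
      by (simp add: block_inv_def J_mat_cube diff_divide_distrib add_divide_distrib)
    also have "rf_t * ?j * ?f - rf_t * ?j + rf_t ^ 3 * (?m * ?j) = 0"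
      unfolding fe by (simp add: algebra_simps power2_eq_square power3_eq_cube)
    finally show ?thesis by simp
  qed
qed

text \<open>Outside its block the matrix is the identity, so the determinant over all arcs is det(I
  + t J(u, v)). Using all arcs puts every block on the same index set, as the product formula for
  orthogonal summands requires.\<close>

lemma det_block:
  "det_on (arcs G) (\<lambda>a b. kron a b + rf_t * rf_const (J_mat G u v a b)) = f_fac G u v"
proof -
  let ?A = "arcs_between G u v"
  \<comment> \<open>\<open>- t J(u, v) = B C\<close> factors through \<open>{u, v}\<close>, which leaves a determinant of size at most two.\<close>
  define B :: "'b \<Rightarrow> 'a \<Rightarrow> ratfun" where
    "B a x = (if a \<in> ?A \<and> tail G a = x then - rf_t else 0)" for a x
  define C :: "'a \<Rightarrow> 'b \<Rightarrow> ratfun" where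
    "C x a = (if a \<in> ?A \<and> head G a = x then 1 else 0)" for a x
  have BC: "mat_mul {u, v} B C a b = - (rf_t * rf_const (J_mat G u v a b))" for a b
  proof -
    let ?P = "a \<in> ?A \<and> b \<in> ?A \<and> tail G a = head G b"
    have tl: "tail G a \<in> {u, v}" if "a \<in> ?A"
      using that by (elim arcs_betweenE) simp_all
    have "mat_mul {u, v} B C a b =
        (\<Sum>x\<in>{u, v}. if tail G a = x then if ?P then - rf_t else 0 else 0)"
      unfolding mat_mul_def B_def C_def by (intro sum.cong refl) auto
    also have "\<dots> = (if tail G a \<in> {u, v} then if ?P then - rf_t else 0 else 0)"
      by (rule sum.delta') simp
    also have "\<dots> = - (rf_t * rf_const (J_mat G u v a b))"
    proof (cases ?P)
      case True
      with tl have "tail G a \<in> {u, v}" by blast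
      with True show ?thesis by (simp only: J_mat_eq if_True simp_thms rf_const_simps mult_1_right)
    next
      case False
      then show ?thesis
        by (simp only: J_mat_eq if_False simp_thms rf_const_simps mult_zero_right minus_zero if_cancel)
    qed
    finally show ?thesis .
  qed
  have CB: "mat_mul (arcs G) C B x y = - (of_nat (card {a \<in> ?A. head G a = x \<and> tail G a = y}) * rf_t)"
    for x y
  proof -
    have "mat_mul (arcs G) C B x y = (\<Sum>a\<in>?A. if head G a = x \<and> tail G a = y then - rf_t else 0)"
      unfolding mat_mul_def
      using arcs_between_subset[of G u v]
      by (intro sum.mono_neutral_cong_right) (auto simp: B_def C_def)
    then show ?thesis by (simp add: sum.If_cases Int_def)
  qed
  have "det_on (arcs G) (\<lambda>a b. kron a b + rf_t * rf_const (J_mat G u v a b)) =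
      det_on (arcs G) (\<lambda>a b. kron a b - mat_mul {u, v} B C a b)"
    by (simp add: BC)
  also have "\<dots> = det_on {u, v} (\<lambda>x y. kron x y - mat_mul (arcs G) C B x y)"
    by (rule det_on_kron_minus_mat_mul_commute) auto
  \<comment> \<open>The (x, y) entry of - C B is t times the number of block arcs from y to x. For
    distinct u and v the diagonal is therefore 1 and the two off-diagonal entries carry the counts
    of the two directions.\<close>
  also have "\<dots> = f_fac G u v"
  proof (cases "u = v")
    case True
    have "{a \<in> arcs_between G u u. head G a = u \<and> tail G a = u} = arcs_from_to G u u"
      unfolding arcs_between_def arcs_from_to_def by blast
    with True show ?thesis by (simp add: det_on_singleton CB f_fac_def kron_def)
  next
    case False
    have sets: "{a \<in> ?A. head G a = u \<and> tail G a = u} = {}"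
      "{a \<in> ?A. head G a = v \<and> tail G a = v} = {}"
      "{a \<in> ?A. head G a = u \<and> tail G a = v} = arcs_from_to G v u"
      "{a \<in> ?A. head G a = v \<and> tail G a = u} = arcs_from_to G u v"
      using False by (auto simp: arcs_between_def arcs_from_to_def)
    show ?thesis
      unfolding det_on_pair[OF False] CB sets using False
      by (simp add: f_fac_def kron_def power2_eq_square mult_ac)
  qed
  finally show ?thesis .
qed

section \<open>Partition of the arcs into the blocks indexed by \<open>Phi\<close>\<close>

lemma finite_Phi [simp]: "finite (Phi G r)"
  by (rule finite_subset[of _ "verts G \<times> verts G"]) (auto simp: Phi_def)

context
  fixes r :: "'a rel"
  assumes r: "linear_order_on (verts G) r"
begin

text \<open>An arc determines its endpoints as an unordered pair, and antisymmetry of the order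
  admits only one arrangement of two distinct vertices.\<close>

lemma Phi_unique:
  assumes "(u, v) \<in> Phi G r" "(u', v') \<in> Phi G r"
    and "a \<in> arcs_between G u v" "a \<in> arcs_between G u' v'"
  shows "(u, v) = (u', v')"
proof -
  have "antisym r" using r by (simp add: order_on_defs)
  moreover have "u = u' \<and> v = v' \<or> u = v' \<and> v = u'"
    using assms(3,4) unfolding arcs_between_iff by metis
  moreover have "(u, v) \<in> r" "(u', v') \<in> r"
    using assms(1,2) by (simp_all add: Phi_def)
  ultimately show ?thesis by (metis antisymD)
qed

text \<open>Totality orders the endpoints of a non-loop, and reflexivity covers loops.\<close>

lemma ex_Phi:
  assumes "a \<in> arcs G"
  shows "\<exists>i\<in>Phi G r. a \<in> arcs_between G (fst i) (snd i)"
proof -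
  have "(tail G a, head G a) \<in> r \<or> (head G a, tail G a) \<in> r"
    using r assms by (cases "tail G a = head G a") (auto simp: order_on_defs refl_on_def total_on_def)
  then show ?thesis
  proof
    assume "(tail G a, head G a) \<in> r"
    then show ?thesis using assms
      by (intro bexI[of _ "(tail G a, head G a)"]) (auto simp: Phi_def arcs_between_iff)
  next
    assume "(head G a, tail G a) \<in> r"
    then show ?thesis using assms
      by (intro bexI[of _ "(head G a, tail G a)"]) (auto simp: Phi_def arcs_between_iff)
  qed
qed

lemma sum_arcs_Phi:
  fixes g :: "'b \<Rightarrow> 'c::comm_monoid_add"
  shows "(\<Sum>a\<in>arcs G. g a) = (\<Sum>(u, v)\<in>Phi G r. \<Sum>a\<in>arcs_between G u v. g a)"
proof -
  have "arcs G = (\<Union>i\<in>Phi G r. arcs_between G (fst i) (snd i))"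
    using ex_Phi by (auto simp: arcs_between_iff)
  moreover have "(\<Sum>a\<in>(\<Union>i\<in>Phi G r. arcs_between G (fst i) (snd i)). g a) =
      (\<Sum>i\<in>Phi G r. \<Sum>a\<in>arcs_between G (fst i) (snd i). g a)"
    using Phi_unique by (intro sum.UNION_disjoint) fastforce+
  ultimately show ?thesis by (simp add: case_prod_unfold)
qed

text \<open>Exactly one block contains a, and every inverse of a lies in that same block, so a
  single summand survives and equals the whole entry.\<close>

lemma eps_eq_sum_J_mat:
  assumes a: "a \<in> arcs G" and b: "b \<in> arcs G"
  shows "eps G a b = (\<Sum>i\<in>Phi G r. J_mat G (fst i) (snd i) a b)"
proof -
  obtain i where i: "i \<in> Phi G r" "a \<in> arcs_between G (fst i) (snd i)"
    using ex_Phi[OF a] by blast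
  have "(\<Sum>j\<in>Phi G r. J_mat G (fst j) (snd j) a b) =
      (\<Sum>j\<in>Phi G r. if j = i then eps G a b else 0)"
  proof (rule sum.cong[OF refl])
    fix j assume "j \<in> Phi G r"
    show "J_mat G (fst j) (snd j) a b = (if j = i then eps G a b else 0)"
    proof (cases "j = i")
      case True
      have "b \<in> arcs_between G (fst i) (snd i)" if "is_inverse G a b"
        using that i(2) unfolding is_inverse_iff arcs_between_iff by metis
      with i(2) show ?thesis unfolding True J_mat_def eps_def by presburger
    next
      case False
      then have "a \<notin> arcs_between G (fst j) (snd j)"
        using Phi_unique[of "fst j" "snd j" "fst i" "snd i" a] i \<open>j \<in> Phi G r\<close>
        by (metis prod.collapse)
      with False show ?thesis by (simp add: J_mat_def)
    qed
  qed
  also have "\<dots> = eps G a b" using i by simp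
  finally show ?thesis ..
qed

end

end

section \<open>Passage from arcs to vertices and expansion over the blocks\<close>

theorem theorem3p4:
  fixes G :: "('v, 'a) pre_digraph"
    and \<tau>1 \<tau>2 :: "'a \<Rightarrow> complex"
    and r :: "'v rel"
  assumes "fin_digraph G"
    and "linear_order_on (verts G) r"
  shows "det_on (arcs G) (\<lambda>a a'. kron a a' - rf_t * rf_const (theta G \<tau>1 \<tau>2 a a')) =
    (\<Prod>(u, v)\<in>Phi G r. f_fac G u v) *
    det_on (verts G) (\<lambda>w z. kron w z - rf_t * A_mat G r \<tau>1 \<tau>2 w z
      + rf_t ^ 2 * D_mat G r \<tau>1 \<tau>2 w z - rf_t ^ 3 * X_mat G r \<tau>1 \<tau>2 w z)"
proof -
  interpret fin_digraph G by fact
  note r = assms(2)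
  let ?S = "arcs G" and ?V = "verts G" and ?I = "Phi G r"
  let ?A = "\<lambda>i. arcs_between G (fst i) (snd i)"
  \<comment> \<open>\<open>E\<close> collects the blocks t J(u, v), and I + F i inverts I + E i.
    Thus N is I + t eps and N' its inverse. The factor t of the remaining part of t theta is put
    into \<open>K\<close>, so that I - t M = N - K L.\<close>
  define E where "E i a b = rf_t * rf_const (J_mat G (fst i) (snd i) a b)" for i a b
  define F where "F i = block_inv G (fst i) (snd i)" for i
  define N where "N a b = kron a b + (\<Sum>i\<in>?I. E i a b)" for a b
  define N' where "N' a b = kron a b + (\<Sum>i\<in>?I. F i a b)" for a b
  define K where "K a w = rf_t * rf_const (\<tau>1 a * kron (head G a) w)" for a w
  define L where "L w a = rf_const (\<tau>2 a * kron w (tail G a))" for w a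
  have E0: "E i a b = 0" if "\<not> (a \<in> ?A i \<and> b \<in> ?A i)" for i a b
    using that by (auto simp: E_def J_mat_def)
  have F0: "F i a b = 0" if "\<not> (a \<in> ?A i \<and> b \<in> ?A i)" for i a b
    using that by (simp add: F_def block_inv_outside)
  have disj: "?A i \<inter> ?A j = {}" if "i \<in> ?I" "j \<in> ?I" "i \<noteq> j" for i j
    using that Phi_unique[OF r, of "fst i" "snd i" "fst j" "snd j"] by (auto simp: prod_eq_iff)

  \<comment> \<open>A nonzero term of the product would need an intermediate arc lying in both
    blocks.\<close>
  have orthE: "mat_mul ?S (E i) (E j) a b = 0" if "i \<in> ?I" "j \<in> ?I" "i \<noteq> j" for i j a b
    unfolding mat_mul_def using disj[OF that] E0 by (intro sum.neutral) (metis disjoint_iff mult_eq_0_iff)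
  have orthF: "mat_mul ?S (E i) (F j) a b = 0" if "i \<in> ?I" "j \<in> ?I" "i \<noteq> j" for i j a b
    unfolding mat_mul_def using disj[OF that] E0 F0
    by (intro sum.neutral) (metis disjoint_iff mult_eq_0_iff)
  have inv: "F i a b + E i a b + mat_mul ?S (E i) (F i) a b = 0" for i a b
    unfolding E_def[abs_def] F_def by (rule block_inv_eq)

  have detN: "det_on ?S N = (\<Prod>(u, v)\<in>?I. f_fac G u v)"
  proof -
    have "det_on ?S N = (\<Prod>i\<in>?I. det_on ?S (\<lambda>a b. kron a b + E i a b))"
      unfolding N_def[abs_def]
      by (rule det_on_kron_plus_sum_orthogonal[OF finite_Phi finite_arcs orthE])
    then show ?thesis by (simp add: E_def det_block case_prod_unfold)
  qed
  have NN': "mat_mul ?S N N' a b = kron a b" if "a \<in> ?S" "b \<in> ?S" for a b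
    unfolding N_def[abs_def] N'_def[abs_def]
    by (rule mat_mul_kron_plus_sum_orthogonal[OF finite_Phi finite_arcs orthF inv that])

  have KL: "mat_mul ?V K L a b = rf_t * rf_const (\<tau>1 a * \<tau>2 b * kron (head G a) (tail G b))"
    if "a \<in> ?S" for a b
  proof -
    have "mat_mul ?V K L a b =
        (\<Sum>w\<in>?V. kron (head G a) w * (rf_t * rf_const (\<tau>1 a) * rf_const (\<tau>2 b) * kron w (tail G b)))"
      unfolding mat_mul_def K_def L_def by (intro sum.cong) (simp_all add: mult_ac)
    \<comment> \<open>The sum over vertices collapses to the head of a, which belongs to
      \<open>verts G\<close>.\<close>
    also have "\<dots> = rf_t * rf_const (\<tau>1 a) * rf_const (\<tau>2 b) * kron (head G a) (tail G b)"
      using that by (intro sum_kron_mult) auto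
    finally show ?thesis by (simp add: mult_ac)
  qed
  have "det_on ?S (\<lambda>a b. kron a b - rf_t * rf_const (theta G \<tau>1 \<tau>2 a b)) =
      det_on ?S (\<lambda>a b. N a b - mat_mul ?V K L a b)"
    by (intro det_on_cong)
       (simp add: KL N_def E_def theta_def eps_eq_sum_J_mat[OF r] algebra_simps sum_distrib_left)
  also have "\<dots> = det_on ?S N * det_on ?V (\<lambda>w z. kron w z - mat_mul ?S L (mat_mul ?S N' K) w z)"
    by (rule det_on_minus_mat_mul[OF finite_arcs finite_verts NN'])
  finally have main: "det_on ?S (\<lambda>a b. kron a b - rf_t * rf_const (theta G \<tau>1 \<tau>2 a b)) =
      (\<Prod>(u, v)\<in>?I. f_fac G u v) *
      det_on ?V (\<lambda>w z. kron w z - mat_mul ?S L (mat_mul ?S N' K) w z)"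
    by (simp only: detN)

  \<comment> \<open>L N' K is L K plus the sum of the L (F i) K. The factor t in \<open>K\<close>
    raises each power of t in F i by one: the - t J terms give - t^2 D, and the t^2 J^2 terms,
    present only for distinct u and v, give t^3 X.\<close>
  have "mat_mul ?S L (mat_mul ?S N' K) w z = rf_t * A_mat G r \<tau>1 \<tau>2 w z
      - rf_t ^ 2 * D_mat G r \<tau>1 \<tau>2 w z + rf_t ^ 3 * X_mat G r \<tau>1 \<tau>2 w z" for w z
  proof -
    have LK: "(\<Sum>a\<in>?S. L w a * K a z) = rf_t * A_mat G r \<tau>1 \<tau>2 w z"
      unfolding sum_arcs_Phi[OF r] A_mat_def sum_distrib_left LK_mat_def mat_mul_def case_prod_unfold
      by (simp add: L_def K_def L_mat_def K_mat_def sum_distrib_left mult_ac)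
    have LFK: "(\<Sum>a\<in>?S. \<Sum>b\<in>?S. L w a * (F i a b * K b z)) =
        (if fst i = snd i then 0
         else rf_t ^ 3 * (rf_const (LJJK_mat G \<tau>1 \<tau>2 (fst i) (snd i) w z) / f_fac G (fst i) (snd i)))
        - rf_t ^ 2 * (rf_const (LJK_mat G \<tau>1 \<tau>2 (fst i) (snd i) w z) / f_fac G (fst i) (snd i))" for i
    proof -
      obtain u v where i: "i = (u, v)" by (cases i)
      let ?B = "arcs_between G u v"
      \<comment> \<open>F i vanishes off its block, so first the row sum and then the column sum
        shrink to the block.\<close>
      have "(\<Sum>a\<in>?S. \<Sum>b\<in>?S. L w a * (F i a b * K b z)) =
          (\<Sum>a\<in>?B. \<Sum>b\<in>?S. L w a * (F i a b * K b z))"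
        using F0[of _ i] by (intro sum.mono_neutral_right) (auto simp: arcs_between_iff i)
      also have "\<dots> = (\<Sum>a\<in>?B. \<Sum>b\<in>?B. L w a * (F i a b * K b z))"
        using F0[of _ i]
        by (intro sum.cong sum.mono_neutral_right refl) (auto simp: arcs_between_iff i)
      \<comment> \<open>\<open>LJK_mat\<close> and \<open>LJJK_mat\<close> multiply by L first, so
        their outer sum runs over the arc paired with K.\<close>
      also have "\<dots> = (\<Sum>b\<in>?B. \<Sum>a\<in>?B. L w a * (F i a b * K b z))"
        by (rule sum.swap)
      also have "\<dots> = (if u = v then 0 else rf_t ^ 3 * (rf_const (LJJK_mat G \<tau>1 \<tau>2 u v w z) / f_fac G u v))
          - rf_t ^ 2 * (rf_const (LJK_mat G \<tau>1 \<tau>2 u v w z) / f_fac G u v)"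
        unfolding LJJK_mat_def LJK_mat_def JJ_mat_def[symmetric]
        by (simp add: mat_mul_def L_def K_def F_def i block_inv_def L_mat_def K_mat_def
            left_diff_distrib right_diff_distrib sum_subtractf sum_distrib_left sum_distrib_right
            sum_divide_distrib power2_eq_square power3_eq_cube mult_ac)
      finally show ?thesis by (simp add: i)
    qed
    have "mat_mul ?S L (mat_mul ?S N' K) w z =
        (\<Sum>a\<in>?S. L w a * (K a z + (\<Sum>b\<in>?S. \<Sum>i\<in>?I. F i a b * K b z)))"
      unfolding mat_mul_def N'_def
      by (intro sum.cong refl) (simp add: distrib_right sum.distrib sum_kron_mult sum_distrib_right)
    also have "\<dots> = (\<Sum>a\<in>?S. L w a * K a z) + (\<Sum>a\<in>?S. \<Sum>b\<in>?S. \<Sum>i\<in>?I. L w a * (F i a b * K b z))"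
      by (simp add: distrib_left sum.distrib sum_distrib_left)
    also have "(\<Sum>a\<in>?S. \<Sum>b\<in>?S. \<Sum>i\<in>?I. L w a * (F i a b * K b z)) =
        (\<Sum>a\<in>?S. \<Sum>i\<in>?I. \<Sum>b\<in>?S. L w a * (F i a b * K b z))"
      by (intro sum.cong refl sum.swap)
    also have "\<dots> = (\<Sum>i\<in>?I. \<Sum>a\<in>?S. \<Sum>b\<in>?S. L w a * (F i a b * K b z))"
      by (rule sum.swap)
    also have "\<dots> = rf_t ^ 3 * X_mat G r \<tau>1 \<tau>2 w z - rf_t ^ 2 * D_mat G r \<tau>1 \<tau>2 w z"
    proof -
      \<comment> \<open>The sum over pairs of distinct vertices is extended by zero to all of
        \<open>Phi\<close>, to match the shape of \<open>LFK\<close>.\<close>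
      have X: "rf_t ^ 3 * X_mat G r \<tau>1 \<tau>2 w z = (\<Sum>i\<in>?I. if fst i = snd i then 0
         else rf_t ^ 3 * (rf_const (LJJK_mat G \<tau>1 \<tau>2 (fst i) (snd i) w z) / f_fac G (fst i) (snd i)))"
        unfolding X_mat_def sum_distrib_left
        by (rule sum.mono_neutral_cong_left) auto
      show ?thesis
        unfolding LFK sum_subtractf X D_mat_def sum_distrib_left by (simp add: case_prod_unfold)
    qed
    finally show ?thesis by (simp add: LK)
  qed
  then show ?thesis
    unfolding main by (intro arg_cong2[where f = "(*)"] refl det_on_cong) (simp add: algebra_simps)
qed

end
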